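(* Let $X$ be a normed space and $C\subset X$ a cone such that $\overline{C^*-C^*}=X^*$ (norm closure in $X^*$). Then the condition $$0_X\notin\overline{C\setminus\epsilon B_X}^{\,\text{weak}}\quad\text{for all }\epsilon\in(0,1)$$ is equivalent to the condition that the cone $C$ has a bounded base.
   Context: Normed spaces are real and not assumed complete; $X^*$ is the dual space of $X$; $0_X$ is the origin of $X$; $B_X$ is the open unit ball of $X$; $\overline{\,\cdot\,}^{\,\text{weak}}$ is the closure in the weak topology of $X$. A cone is a nonempty convex subset $C\subset X$ with $\alpha C\subset C$ for all real $\alpha\ge0$ (not assumed closed). The dual cone is $C^*=\{f\in X^*: f(c)\ge0\ \forall c\in C\}$. A base for a cone $C$ is a nonempty convex subset $B\subset C$ such that $0_X\notin\overline{B}$ (norm closure) and each $c\in C\setminus\{0_X\}$ has a unique representation of the form $c=\lambda b$ with $\lambda>0$ and $b\in B$. It is a bounded base if it is a bounded subset of $X$.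
   Formalization: The cone C is additionally assumed to be different from {0_X}; for C = {0_X} the weak-closure condition holds vacuously, but no base exists, so the equivalence fails. *)

theory Defs
  imports "HOL-Analysis.Analysis"
begin

text \<open>The dual space of \<open>'a\<close> is the type \<open>'a \<Rightarrow>\<^sub>L real\<close> of bounded linear functionals with the
  operator norm. Cones are given by the library predicate \<^const>\<open>convex_cone\<close>
  (nonempty, convex, stable under multiplication by all nonnegative reals).\<close>

definition dual_cone :: "'a::real_normed_vector set \<Rightarrow> ('a \<Rightarrow>\<^sub>L real) set" where
  "dual_cone C = {f. \<forall>c\<in>C. 0 \<le> blinfun_apply f c}"

text \<open>The coarsest topology for which all bounded linear functionals are continuous.\<close>

definition weak_topology :: "'a::real_normed_vector topology" where
  "weak_topology = topology_generated_by
     {blinfun_apply f -` U | (f :: 'a \<Rightarrow>\<^sub>L real) U. open U}"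

text \<open>The representation \<open>c = \<lambda> b\<close> is unique as a pair \<open>(\<lambda>, b)\<close>. As \<open>B\<close> has to be nonempty
  with \<open>0 \<notin> closure B\<close>, the cone \<open>{0}\<close> has no base.\<close>

definition is_base :: "'a::real_normed_vector set \<Rightarrow> 'a set \<Rightarrow> bool" where
  "is_base C B \<longleftrightarrow>
     B \<noteq> {} \<and> convex B \<and> B \<subseteq> C \<and> 0 \<notin> closure B \<and>
     (\<forall>c \<in> C - {0}. \<exists>!p :: real \<times> 'a. fst p > 0 \<and> snd p \<in> B \<and> c = fst p *\<^sub>R snd p)"

end

theory Submission
  imports Defs
begin

text \<open>
  Both conditions are equivalent to the existence of a bounded linear functional \<open>F\<close> that
  dominates the norm on the cone, that is \<open>\<parallel>c\<parallel> \<le> F c\<close> for all \<open>c \<in> C\<close>.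

  Such an \<open>F\<close> cuts out the bounded base \<open>{c \<in> C. F c = 1}\<close>. Conversely, a base \<open>B\<close> is convex
  and stays away from the origin, so that Hahn--Banach gives a functional that is at least \<open>1\<close>
  on \<open>B\<close>; if \<open>B\<close> is bounded by \<open>M\<close>, then \<open>M\<close> times this functional dominates the norm on \<open>B\<close>,
  hence on all of \<open>C\<close> (\<open>bounded_base_iff_norm_dominated\<close>).

  If \<open>F\<close> dominates the norm on \<open>C\<close>, then the weak neighbourhood \<open>{x. F x < \<epsilon>}\<close> of the origin
  misses every \<open>c \<in> C\<close> with \<open>\<parallel>c\<parallel> \<ge> \<epsilon>\<close>. For the other direction, a single \<open>\<epsilon>\<close> is enough: a
  basic weak neighbourhood of the origin that misses the large elements of \<open>C\<close> yields, by
  homogeneity, \<open>\<parallel>c\<parallel> \<le> K (\<bar>f\<^sub>1 c\<bar> + \<dots> + \<bar>f\<^sub>n c\<bar>)\<close> on \<open>C\<close>. The density hypothesis allows to replace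
  each \<open>f\<^sub>i\<close>, up to a small multiple of the norm, by a difference \<open>g\<^sub>i - h\<^sub>i\<close> of functionals that
  are nonnegative on \<open>C\<close>. There \<open>\<bar>g\<^sub>i c - h\<^sub>i c\<bar> \<le> g\<^sub>i c + h\<^sub>i c\<close>, the error terms are absorbed on the
  left, and a multiple of \<open>\<Sum>\<^sub>i (g\<^sub>i + h\<^sub>i)\<close> dominates the norm (\<open>norm_dominated_if_weakly_separated\<close>).
\<close>

section \<open>Linear functionals below a sublinear one\<close>

definition sublinear :: "('a::real_vector \<Rightarrow> real) \<Rightarrow> bool" where
  "sublinear p \<longleftrightarrow> (\<forall>x y. p (x + y) \<le> p x + p y) \<and> (\<forall>t x. 0 \<le> t \<longrightarrow> p (t *\<^sub>R x) = t * p x)"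

lemma sublinear_add: "sublinear p \<Longrightarrow> p (x + y) \<le> p x + p y"
  by (simp add: sublinear_def)

lemma sublinear_scale: "sublinear p \<Longrightarrow> 0 \<le> t \<Longrightarrow> p (t *\<^sub>R x) = t * p x"
  by (simp add: sublinear_def)

lemma sublinear_zero: "sublinear p \<Longrightarrow> p 0 = 0"
  using sublinear_scale[of p 0 0] by simp

lemma sublinear_minus: "sublinear p \<Longrightarrow> - p (- x) \<le> p x"
  using sublinear_add[of p x "- x"] sublinear_zero[of p] by simp

text \<open>An infimum of functions is easily bounded from above only, so it is convenient to check
  homogeneity as an inequality; the reverse inequality is the one for \<open>1 / t\<close>.\<close>

lemma sublinearI:
  assumes add: "\<And>x y. p (x + y) \<le> p x + p y"
    and scale: "\<And>t x. 0 < t \<Longrightarrow> p (t *\<^sub>R x) \<le> t * p x"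
  shows "sublinear p"
proof -
  have pos: "p (t *\<^sub>R x) = t * p x" if t: "0 < t" for t x
  proof -
    have "p x \<le> inverse t * p (t *\<^sub>R x)"
      using scale[of "inverse t" "t *\<^sub>R x"] t by simp
    then have "t * p x \<le> p (t *\<^sub>R x)"
      using t by (simp add: field_simps)
    with scale[OF t, of x] show ?thesis by simp
  qed
  have "p 0 = 0"
    using pos[of 2 0] by simp
  then have "p (t *\<^sub>R x) = t * p x" if "0 \<le> t" for t x
    using pos[of t x] that by (cases "t = 0") auto
  with add show ?thesis by (simp add: sublinear_def)
qed

text \<open>The cone \<open>S\<close> collects demands: a pair \<open>(y, s)\<close> asks for a linear functional with value at
  least \<open>s\<close> at \<open>y\<close>. Lowering \<open>p\<close> to the infimum of \<open>p (x + y) - s\<close> over all demands makes every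
  linear functional below the new function meet them.\<close>

lemma sublinear_lower:
  assumes p: "sublinear p" and S: "convex_cone S"
    and le: "\<And>y s. (y, s) \<in> S \<Longrightarrow> s \<le> p y"
  obtains q where "sublinear q" "q \<le> p" "\<And>y s. (y, s) \<in> S \<Longrightarrow> q (- y) \<le> - s"
proof -
  define q where "q x = (INF (y, s)\<in>S. p (x + y) - s)" for x
  have "- p (- x) \<le> p (x + y) - s" if "(y, s) \<in> S" for x y s
    using le[OF that] sublinear_add[OF p, of "x + y" "- x"] by simp
  then have bdd: "bdd_below ((\<lambda>(y, s). p (x + y) - s) ` S)" for x
    by (intro bdd_belowI2[where m = "- p (- x)"]) auto
  have lower: "q x \<le> p (x + y) - s" if "(y, s) \<in> S" for x y s
    using cINF_lower[OF bdd[of x] that] by (simp add: q_def)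
  have greatest: "m \<le> q x" if "\<And>y s. (y, s) \<in> S \<Longrightarrow> m \<le> p (x + y) - s" for m x
    unfolding q_def using that convex_cone_nonempty[OF S] by (intro cINF_greatest) auto
  have zero: "(0, 0) \<in> S"
    using convex_cone_contains_0[OF S] by (simp add: zero_prod_def)
  have "sublinear q"
  proof (rule sublinearI)
    fix x y
    have *: "q (x + y) \<le> (p (x + a) - s) + (p (y + b) - t)"
      if "(a, s) \<in> S" "(b, t) \<in> S" for a s b t
    proof -
      have "(a + b, s + t) \<in> S"
        using convex_cone_add[OF S that] by simp
      from lower[OF this, of "x + y"] sublinear_add[OF p, of "x + a" "y + b"]
      show ?thesis by (simp add: algebra_simps)
    qed
    have "q (x + y) - (p (x + a) - s) \<le> q y" if "(a, s) \<in> S" for a s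
    proof (rule greatest)
      show "q (x + y) - (p (x + a) - s) \<le> p (y + b) - t" if "(b, t) \<in> S" for b t
        using *[OF \<open>(a, s) \<in> S\<close> that] by simp
    qed
    then have "q (x + y) - q y \<le> p (x + a) - s" if "(a, s) \<in> S" for a s
      using that by (simp add: algebra_simps)
    then have "q (x + y) - q y \<le> q x"
      by (rule greatest)
    then show "q (x + y) \<le> q x + q y" by simp
  next
    fix t :: real and x
    assume t: "0 < t"
    have "q (t *\<^sub>R x) / t \<le> q x"
    proof (rule greatest)
      fix y s
      assume "(y, s) \<in> S"
      then have "(t *\<^sub>R y, t * s) \<in> S"
        using convex_cone_scaleR[OF S, of t "(y, s)"] t by simp
      from lower[OF this, of "t *\<^sub>R x"]
      have "q (t *\<^sub>R x) \<le> t * (p (x + y) - s)"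
        using sublinear_scale[OF p, of t "x + y"] t by (simp add: algebra_simps)
      then show "q (t *\<^sub>R x) / t \<le> p (x + y) - s"
        using t by (simp add: field_simps)
    qed
    then show "q (t *\<^sub>R x) \<le> t * q x"
      using t by (simp add: field_simps)
  qed
  moreover have "q \<le> p"
    using lower[OF zero] by (simp add: le_fun_def)
  moreover have "q (- y) \<le> - s" if "(y, s) \<in> S" for y s
    using lower[OF that, of "- y"] sublinear_zero[OF p] by simp
  ultimately show ?thesis by (rule that)
qed

text \<open>Zorn's lemma applies since the pointwise infimum of a chain is again sublinear; it is finite
  because every sublinear \<open>q \<le> p\<close> satisfies \<open>q x \<ge> - p (- x)\<close>.\<close>

lemma minimal_sublinear_exists:
  assumes p: "sublinear p"
  obtains q where "sublinear q" "q \<le> p" "\<And>r. sublinear r \<Longrightarrow> r \<le> q \<Longrightarrow> r = q"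
proof -
  define A where "A = {q. sublinear q \<and> q \<le> p}"
  have "\<exists>m\<in>A. \<forall>a\<in>A. a \<le> m \<longrightarrow> a = m"
  proof (rule predicate_Zorn[where P = "\<lambda>a b. b \<le> a"])
    show "partial_order_on A (relation_of (\<lambda>a b. b \<le> a) A)"
      by (rule partial_order_on_relation_ofI) auto
  next
    fix Ch
    assume Ch: "Ch \<in> Chains (relation_of (\<lambda>a b. b \<le> a) A)"
    then have sub: "Ch \<subseteq> A"
      and total: "\<And>a b. a \<in> Ch \<Longrightarrow> b \<in> Ch \<Longrightarrow> a \<le> b \<or> b \<le> a"
      unfolding Chains_def relation_of_def by auto
    show "\<exists>u\<in>A. \<forall>a\<in>Ch. u \<le> a"
    proof (cases "Ch = {}")
      case True
      with p show ?thesis by (auto simp: A_def)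
    next
      case False
      define u where "u x = (INF q\<in>Ch. q x)" for x
      have "- p (- x) \<le> q x" if "q \<in> Ch" for q x
      proof -
        from that sub have "sublinear q" "q (- x) \<le> p (- x)"
          by (auto simp: A_def le_fun_def)
        with sublinear_minus[of q x] show ?thesis by simp
      qed
      then have bdd: "bdd_below ((\<lambda>q. q x) ` Ch)" for x
        by (intro bdd_belowI2[where m = "- p (- x)"]) auto
      have lower: "u x \<le> q x" if "q \<in> Ch" for q x
        unfolding u_def by (rule cINF_lower[OF bdd that])
      have greatest: "m \<le> u x" if "\<And>q. q \<in> Ch \<Longrightarrow> m \<le> q x" for m x
        unfolding u_def using that False by (intro cINF_greatest) auto
      have sl: "sublinear q" if "q \<in> Ch" for q
        using that sub by (auto simp: A_def)
      have "sublinear u"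
      proof (rule sublinearI)
        fix x y
        have *: "u (x + y) \<le> q x + r y" if "q \<in> Ch" "r \<in> Ch" for q r
        proof -
          \<comment> \<open>the smaller of the two members of the chain serves for both summands\<close>
          obtain s where s: "s \<in> Ch" "s \<le> q" "s \<le> r"
            using total[OF \<open>q \<in> Ch\<close> \<open>r \<in> Ch\<close>] \<open>q \<in> Ch\<close> \<open>r \<in> Ch\<close> by blast
          then have "s x \<le> q x" "s y \<le> r y"
            by (auto simp: le_fun_def)
          with lower[OF s(1), of "x + y"] sublinear_add[OF sl[OF s(1)], of x y]
          show ?thesis by simp
        qed
        have "u (x + y) - q x \<le> u y" if "q \<in> Ch" for q
        proof (rule greatest)
          show "u (x + y) - q x \<le> r y" if "r \<in> Ch" for r
            using *[OF \<open>q \<in> Ch\<close> that] by simp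
        qed
        then have "u (x + y) - u y \<le> q x" if "q \<in> Ch" for q
          using that by (simp add: algebra_simps)
        then have "u (x + y) - u y \<le> u x"
          by (rule greatest)
        then show "u (x + y) \<le> u x + u y" by simp
      next
        fix t :: real and x
        assume t: "0 < t"
        have "u (t *\<^sub>R x) / t \<le> u x"
        proof (rule greatest)
          fix q
          assume q: "q \<in> Ch"
          show "u (t *\<^sub>R x) / t \<le> q x"
            using lower[OF q, of "t *\<^sub>R x"] sublinear_scale[OF sl[OF q], of t x] t
            by (simp add: field_simps)
        qed
        then show "u (t *\<^sub>R x) \<le> t * u x"
          using t by (simp add: field_simps)
      qed
      moreover from False obtain q where "q \<in> Ch" by blast
      then have "u \<le> q" "q \<le> p"
        using lower sub by (auto simp: A_def le_fun_def)
      then have "u \<le> p" by (rule order_trans)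
      ultimately have "u \<in> A" by (simp add: A_def)
      moreover have "\<forall>a\<in>Ch. u \<le> a"
        using lower by (auto simp: le_fun_def)
      ultimately show ?thesis by blast
    qed
  qed
  then obtain m where m: "m \<in> A" "\<And>a. a \<in> A \<Longrightarrow> a \<le> m \<Longrightarrow> a = m"
    by blast
  show thesis
  proof (rule that[of m])
    show "r = m" if "sublinear r" "r \<le> m" for r
      using m that by (auto simp: A_def intro: order_trans)
  qed (use m(1) in \<open>auto simp: A_def\<close>)
qed

text \<open>A minimal \<open>q\<close> is not changed by imposing the demand that the value at \<open>y\<close> be at least \<open>q y\<close>.
  Hence it meets this demand itself, that is, \<open>q (- y) \<le> - q y\<close>.\<close>

lemma minimal_sublinear_linear:
  assumes q: "sublinear q" and minimal: "\<And>r. sublinear r \<Longrightarrow> r \<le> q \<Longrightarrow> r = q"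
  shows "linear q"
proof -
  have neg: "q (- y) = - q y" for y
  proof -
    define S where "S = (\<lambda>t. (t *\<^sub>R y, t * q y)) ` {0..}"
    have "convex_cone S"
      unfolding convex_cone_iff
    proof (intro conjI ballI allI impI)
      show "0 \<in> S"
        unfolding S_def by (rule image_eqI[where x = 0]) (auto simp: zero_prod_def)
    next
      fix u v
      assume "u \<in> S" "v \<in> S"
      then obtain t t' where "0 \<le> t" "0 \<le> t'" "u = (t *\<^sub>R y, t * q y)" "v = (t' *\<^sub>R y, t' * q y)"
        by (auto simp: S_def)
      then show "u + v \<in> S"
        unfolding S_def by (intro image_eqI[where x = "t + t'"]) (auto simp: algebra_simps)
    next
      fix u and c :: real
      assume "u \<in> S" "0 \<le> c"
      then obtain t where "0 \<le> t" "u = (t *\<^sub>R y, t * q y)"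
        by (auto simp: S_def)
      with \<open>0 \<le> c\<close> show "c *\<^sub>R u \<in> S"
        unfolding S_def by (intro image_eqI[where x = "c * t"]) auto
    qed
    moreover have "s \<le> q z" if "(z, s) \<in> S" for z s
      using that sublinear_scale[OF q] by (auto simp: S_def)
    ultimately obtain r where r: "sublinear r" "r \<le> q" "\<And>z s. (z, s) \<in> S \<Longrightarrow> r (- z) \<le> - s"
      using sublinear_lower[OF q] by metis
    have "(y, q y) \<in> S"
      unfolding S_def by (rule image_eqI[where x = 1]) auto
    then have "q (- y) \<le> - q y"
      using r(3) minimal[OF r(1,2)] by blast
    with sublinear_minus[OF q, of "- y"] show ?thesis by simp
  qed
  show ?thesis
  proof (rule linearI)
    fix x y
    have "q x \<le> q (x + y) - q y"
      using sublinear_add[OF q, of "x + y" "- y"] neg[of y] by simp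
    with sublinear_add[OF q, of x y] show "q (x + y) = q x + q y" by simp
  next
    fix t :: real and x
    show "q (t *\<^sub>R x) = t *\<^sub>R q x"
    proof (cases "0 \<le> t")
      case True
      with sublinear_scale[OF q] show ?thesis by simp
    next
      case False
      with sublinear_scale[OF q, of "- t" x] neg[of "t *\<^sub>R x"] show ?thesis by simp
    qed
  qed
qed

text \<open>A form of the Mazur--Orlicz theorem. The Hahn--Banach extension theorem is the case where
  \<open>S\<close> is the graph of a linear functional on a subspace.\<close>

theorem linear_functional_above_cone:
  assumes "sublinear p" "convex_cone S" "\<And>y s. (y, s) \<in> S \<Longrightarrow> s \<le> p y"
  obtains f where "linear f" "\<And>x. f x \<le> p x" "\<And>y s. (y, s) \<in> S \<Longrightarrow> s \<le> f y"
proof -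
  obtain q where q: "sublinear q" "q \<le> p" "\<And>y s. (y, s) \<in> S \<Longrightarrow> q (- y) \<le> - s"
    using sublinear_lower[OF assms] by metis
  obtain f where f: "sublinear f" "f \<le> q" "\<And>r. sublinear r \<Longrightarrow> r \<le> f \<Longrightarrow> r = f"
    using minimal_sublinear_exists[OF q(1)] by metis
  have lin: "linear f"
    using f(1,3) by (rule minimal_sublinear_linear)
  show ?thesis
  proof (rule that[OF lin])
    show "f x \<le> p x" for x
      using f(2) q(2) by (meson le_funD order_trans)
    show "s \<le> f y" if "(y, s) \<in> S" for y s
      using q(3)[OF that] le_funD[OF f(2), of "- y"] linear_neg[OF lin, of y] by simp
  qed
qed

section \<open>Separation of a convex set from the origin\<close>

text \<open>If \<open>B\<close> misses the ball of radius \<open>r\<close>, then asking for the value \<open>1\<close> at each \<open>b \<in> B\<close> is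
  compatible with the bound \<open>\<parallel>x\<parallel> / r\<close>. Convexity makes the multiples of these demands a convex
  cone.\<close>

lemma separate_convex_from_zero:
  fixes B :: "'a::real_normed_vector set"
  assumes "convex B" "0 \<notin> closure B"
  obtains f :: "'a \<Rightarrow>\<^sub>L real" where "\<And>b. b \<in> B \<Longrightarrow> 1 \<le> blinfun_apply f b"
proof (cases "B = {}")
  case True
  then show ?thesis using that by blast
next
  case False
  obtain r where r: "0 < r" "\<And>b. b \<in> B \<Longrightarrow> r \<le> norm b"
    using assms(2) unfolding closure_approachable by (auto simp: not_less)
  define p :: "'a \<Rightarrow> real" where "p x = norm x / r" for x
  have p: "sublinear p"
  proof (rule sublinearI)
    show "p (x + y) \<le> p x + p y" for x y
      using r(1) norm_triangle_ineq[of x y] by (simp add: p_def divide_simps)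
  qed (simp add: p_def)
  define S where "S = convex_cone hull (B \<times> {1::real})"
  have "convex (B \<times> {1::real})"
    using assms(1) by (intro convex_Times) auto
  then have S_eq: "S = (\<Union>x\<in>B \<times> {1}. \<Union>c\<in>{0..}. {c *\<^sub>R x})"
    unfolding S_def using False
    by (subst convex_cone_hull_convex_hull_nonempty) (auto simp: hull_same)
  have "s \<le> p y" if "(y, s) \<in> S" for y s
    using that r by (auto simp: S_eq p_def pos_le_divide_eq intro!: mult_left_mono)
  then obtain f where f: "linear f" "\<And>x. f x \<le> p x" "\<And>y s. (y, s) \<in> S \<Longrightarrow> s \<le> f y"
    using linear_functional_above_cone[OF p, of S]
    by (metis S_def convex_cone_convex_cone_hull)
  have "norm (f x) \<le> norm x * (1 / r)" for x
    using f(2)[of x] f(2)[of "- x"] linear_neg[OF f(1), of x] by (simp add: p_def abs_le_iff)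
  with f(1) have "bounded_linear f"
    by (intro bounded_linear_intro[where K = "1 / r"]) (auto simp: linear_add linear_scale)
  then have apply_f: "blinfun_apply (Blinfun f) = f"
    by (rule bounded_linear_Blinfun_apply)
  show ?thesis
  proof (rule that[of "Blinfun f"])
    fix b
    assume "b \<in> B"
    then have "(b, 1) \<in> S"
      unfolding S_def by (simp add: hull_inc)
    then show "1 \<le> blinfun_apply (Blinfun f) b"
      by (simp add: apply_f f(3))
  qed
qed

section \<open>Bounded bases and functionals that dominate the norm\<close>

lemma bounded_base_iff_norm_dominated:
  fixes C :: "'a::real_normed_vector set"
  assumes C: "convex_cone C" "C \<noteq> {0}"
  shows "(\<exists>B. is_base C B \<and> bounded B) \<longleftrightarrow> (\<exists>F :: 'a \<Rightarrow>\<^sub>L real. \<forall>c\<in>C. norm c \<le> blinfun_apply F c)"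
    (is "?base \<longleftrightarrow> ?dom")
proof
  assume ?base
  then obtain B where B: "is_base C B" "bounded B" by blast
  obtain M where M: "0 < M" "\<And>b. b \<in> B \<Longrightarrow> norm b \<le> M"
    using B(2) by (auto simp: bounded_pos)
  obtain f :: "'a \<Rightarrow>\<^sub>L real" where f: "\<And>b. b \<in> B \<Longrightarrow> 1 \<le> blinfun_apply f b"
    using separate_convex_from_zero[of B] B(1) by (auto simp: is_base_def)
  have "norm c \<le> blinfun_apply (M *\<^sub>R f) c" if "c \<in> C" for c
  proof (cases "c = 0")
    case False
    with B(1) that obtain p :: "real \<times> 'a"
      where p: "0 < fst p" "snd p \<in> B" "c = fst p *\<^sub>R snd p"
      unfolding is_base_def by blast
    have "norm (snd p) \<le> M * blinfun_apply f (snd p)"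
      using M(2)[OF p(2)] mult_left_mono[OF f[OF p(2)], of M] M(1) by linarith
    then have "fst p * norm (snd p) \<le> fst p * (M * blinfun_apply f (snd p))"
      using p(1) by (intro mult_left_mono) auto
    then show ?thesis
      using p(1) by (simp add: p(3) blinfun.scaleR_left blinfun.scaleR_right mult_ac)
  qed simp
  then show ?dom by blast
next
  assume ?dom
  then obtain F :: "'a \<Rightarrow>\<^sub>L real" where F: "\<And>c. c \<in> C \<Longrightarrow> norm c \<le> blinfun_apply F c"
    by blast
  define B where "B = {c \<in> C. blinfun_apply F c = 1}"
  have F_pos: "0 < blinfun_apply F c" if "c \<in> C - {0}" for c
    using F[of c] that zero_less_norm_iff[of c] by (smt (verit) DiffE insertI1)
  have normalise: "inverse (blinfun_apply F c) *\<^sub>R c \<in> B" if "c \<in> C - {0}" for c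
    using F_pos[OF that] that convex_cone_scaleR[OF C(1)]
    by (auto simp: B_def blinfun.scaleR_right)
  have "\<exists>!p :: real \<times> 'a. fst p > 0 \<and> snd p \<in> B \<and> c = fst p *\<^sub>R snd p" if c: "c \<in> C - {0}" for c
  proof (rule ex1I[where a = "(blinfun_apply F c, inverse (blinfun_apply F c) *\<^sub>R c)"])
    show "p = (blinfun_apply F c, inverse (blinfun_apply F c) *\<^sub>R c)"
      if "fst p > 0 \<and> snd p \<in> B \<and> c = fst p *\<^sub>R snd p" for p
    proof -
      have "blinfun_apply F c = fst p"
        using that by (auto simp: B_def blinfun.scaleR_right)
      with that show ?thesis by (auto simp: prod_eq_iff)
    qed
  qed (use F_pos[OF c] normalise[OF c] in auto)
  moreover have "B \<noteq> {}"
    using normalise C convex_cone_contains_0[OF C(1)] by blast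
  moreover have "convex B"
  proof -
    have "convex (C \<inter> {x. blinfun_apply F x = 1})"
      using C(1) by (intro convex_Int)
        (auto simp: convex_cone_def convex_def blinfun.add_right blinfun.scaleR_right)
    then show ?thesis by (simp add: B_def Int_def)
  qed
  moreover have "0 \<notin> closure B"
  proof -
    have "closure B \<subseteq> {x. blinfun_apply F x = 1}"
      by (rule closure_minimal) (auto simp: B_def intro!: closed_Collect_eq continuous_intros)
    then show ?thesis by auto
  qed
  moreover have "bounded B"
    using F by (force simp: bounded_iff B_def intro!: exI[of _ 1])
  ultimately show ?base
    unfolding is_base_def by (intro exI[of _ B]) (auto simp: B_def)
qed

section \<open>Weak neighbourhoods of the origin\<close>

lemma openin_weak_topology_vimage:
  assumes "open U"
  shows "openin weak_topology (blinfun_apply (f :: 'a::real_normed_vector \<Rightarrow>\<^sub>L real) -` U)"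
  unfolding weak_topology_def using assms by (intro topology_generated_by_Basis) blast

lemma topspace_weak_topology [simp]: "topspace weak_topology = UNIV"
  using openin_weak_topology_vimage[of UNIV 0] openin_subset by force

lemma weak_neighbourhood_contains_basic:
  fixes T :: "'a::real_normed_vector set"
  assumes "openin weak_topology T" "x \<in> T"
  obtains I :: "('a \<Rightarrow>\<^sub>L real) set" and \<delta> where "finite I" "0 < \<delta>"
    "\<And>y. (\<And>f. f \<in> I \<Longrightarrow> \<bar>blinfun_apply f (y - x)\<bar> < \<delta>) \<Longrightarrow> y \<in> T"
proof -
  have "generate_topology_on {blinfun_apply f -` U | (f :: 'a \<Rightarrow>\<^sub>L real) U. open U} T"
    using assms(1) by (simp add: weak_topology_def openin_topology_generated_by_iff)
  then have "x \<in> T \<Longrightarrow> \<exists>(I :: ('a \<Rightarrow>\<^sub>L real) set) \<delta>. finite I \<and> 0 < \<delta> \<and>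
    (\<forall>y. (\<forall>f\<in>I. \<bar>blinfun_apply f (y - x)\<bar> < \<delta>) \<longrightarrow> y \<in> T)"
  proof induction
    case Empty
    then show ?case by simp
  next
    case (Int a b)
    then have x: "x \<in> a" "x \<in> b" by auto
    obtain I :: "('a \<Rightarrow>\<^sub>L real) set" and \<delta> where I: "finite I" "0 < \<delta>"
      "\<And>y. (\<forall>f\<in>I. \<bar>blinfun_apply f (y - x)\<bar> < \<delta>) \<Longrightarrow> y \<in> a"
      using Int.IH(1)[OF x(1)] by blast
    obtain J :: "('a \<Rightarrow>\<^sub>L real) set" and \<eta> where J: "finite J" "0 < \<eta>"
      "\<And>y. (\<forall>f\<in>J. \<bar>blinfun_apply f (y - x)\<bar> < \<eta>) \<Longrightarrow> y \<in> b"
      using Int.IH(2)[OF x(2)] by blast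
    have "y \<in> a \<inter> b" if "\<forall>f\<in>I \<union> J. \<bar>blinfun_apply f (y - x)\<bar> < min \<delta> \<eta>" for y
      using I(3)[of y] J(3)[of y] that by simp
    with I(1,2) J(1,2) show ?case
      by (intro exI[of _ "I \<union> J"] exI[of _ "min \<delta> \<eta>"]) simp
  next
    case (UN K)
    then obtain k where "k \<in> K" "x \<in> k" by blast
    from UN.IH[OF this] \<open>k \<in> K\<close> show ?case by (meson UnionI)
  next
    case (Basis s)
    then obtain f :: "'a \<Rightarrow>\<^sub>L real" and U
      where s: "s = blinfun_apply f -` U" "open U" by blast
    with Basis(2) obtain \<delta> where "0 < \<delta>" "\<And>z. dist z (blinfun_apply f x) < \<delta> \<Longrightarrow> z \<in> U"
      by (auto simp: open_dist)
    then show ?case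
      by (intro exI[of _ "{f}"] exI[of _ \<delta>])
        (auto simp: s(1) dist_real_def blinfun.diff_right)
  qed
  with assms(2) obtain I :: "('a \<Rightarrow>\<^sub>L real) set" and \<delta> where I: "finite I" "0 < \<delta>"
    "\<forall>y. (\<forall>f\<in>I. \<bar>blinfun_apply f (y - x)\<bar> < \<delta>) \<longrightarrow> y \<in> T"
    by iprover
  show ?thesis
    using I by (intro that[of I \<delta>]) simp_all
qed

lemma zero_notin_weak_closure_if_norm_dominated:
  fixes F :: "'a::real_normed_vector \<Rightarrow>\<^sub>L real"
  assumes F: "\<And>c. c \<in> C \<Longrightarrow> norm c \<le> blinfun_apply F c" and "0 < \<epsilon>"
  shows "0 \<notin> weak_topology closure_of (C - ball 0 \<epsilon>)"
proof
  assume "0 \<in> weak_topology closure_of (C - ball 0 \<epsilon>)"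
  moreover have "0 \<in> blinfun_apply F -` {..<\<epsilon>}"
    using assms(2) by simp
  moreover have "openin weak_topology (blinfun_apply F -` {..<\<epsilon>})"
    by (simp add: openin_weak_topology_vimage)
  ultimately obtain c where "c \<in> C - ball 0 \<epsilon>" "c \<in> blinfun_apply F -` {..<\<epsilon>}"
    unfolding in_closure_of by meson
  with F[of c] show False by simp
qed

text \<open>Scaling \<open>c\<close> into a basic weak neighbourhood of the origin that misses \<open>C - ball 0 \<epsilon>\<close> brings it
  into the ball, and the scaling factor bounds \<open>\<parallel>c\<parallel>\<close>. The functionals may all vanish at \<open>c\<close>, so
  that the right-hand side is \<open>0\<close>; therefore the bound is shown for every \<open>u\<close> above the right-hand
  side, where scaling by \<open>\<epsilon> / u\<close> makes sense.\<close>

lemma norm_le_sum_functionals: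
  fixes C :: "'a::real_normed_vector set"
  assumes C: "convex_cone C" and "0 < \<epsilon>"
    and weak: "0 \<notin> weak_topology closure_of (C - ball 0 \<epsilon>)"
  obtains I :: "('a \<Rightarrow>\<^sub>L real) set" and K where "finite I" "0 < K"
    "\<And>c. c \<in> C \<Longrightarrow> norm c \<le> K * (\<Sum>f\<in>I. \<bar>blinfun_apply f c\<bar>)"
proof -
  obtain T where T: "openin weak_topology T" "0 \<in> T" "\<And>c. c \<in> C \<Longrightarrow> c \<in> T \<Longrightarrow> norm c < \<epsilon>"
    using weak unfolding in_closure_of by auto
  obtain I :: "('a \<Rightarrow>\<^sub>L real) set" and \<delta> where I: "finite I" "0 < \<delta>"
    "\<And>y. (\<And>f. f \<in> I \<Longrightarrow> \<bar>blinfun_apply f (y - 0)\<bar> < \<delta>) \<Longrightarrow> y \<in> T"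
    using weak_neighbourhood_contains_basic[OF T(1,2)] by metis
  have "norm c \<le> \<epsilon> / \<delta> * (\<Sum>f\<in>I. \<bar>blinfun_apply f c\<bar>)" if c: "c \<in> C" for c
  proof (rule dense_ge)
    fix u
    assume u: "\<epsilon> / \<delta> * (\<Sum>f\<in>I. \<bar>blinfun_apply f c\<bar>) < u"
    have "0 \<le> \<epsilon> / \<delta> * (\<Sum>f\<in>I. \<bar>blinfun_apply f c\<bar>)"
      using I(2) assms(2) by (intro mult_nonneg_nonneg sum_nonneg) auto
    with u have u_pos: "0 < u" by linarith
    have "(\<epsilon> / u) *\<^sub>R c \<in> T"
    proof (rule I(3))
      fix f
      assume "f \<in> I"
      then have "\<bar>blinfun_apply f c\<bar> \<le> (\<Sum>f\<in>I. \<bar>blinfun_apply f c\<bar>)"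
        using I(1) by (intro member_le_sum) auto
      also have "\<dots> < \<delta> * u / \<epsilon>"
        using u I(2) assms(2) by (simp add: field_simps)
      finally show "\<bar>blinfun_apply f ((\<epsilon> / u) *\<^sub>R c - 0)\<bar> < \<delta>"
        using u_pos assms(2) by (simp add: blinfun.scaleR_right abs_mult field_simps)
    qed
    moreover have "(\<epsilon> / u) *\<^sub>R c \<in> C"
      using convex_cone_scaleR[OF C _ c] u_pos assms(2) by simp
    ultimately have "norm ((\<epsilon> / u) *\<^sub>R c) < \<epsilon>"
      by (intro T(3))
    then show "norm c \<le> u"
      using u_pos assms(2) by (simp add: field_simps)
  qed
  with I(1,2) assms(2) show ?thesis by (intro that[of I "\<epsilon> / \<delta>"]) auto
qed

text \<open>With \<open>n\<close> functionals in the previous bound, the approximation error \<open>\<eta>\<close> is chosen such that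
  \<open>K n \<eta> \<le> 1/2\<close>; the remaining half of the norm accounts for the factor \<open>2 K\<close>.\<close>

lemma norm_dominated_if_weakly_separated:
  fixes C :: "'a::real_normed_vector set"
  assumes C: "convex_cone C" and \<epsilon>: "0 < \<epsilon>"
    and dense: "closure {f - g | f g. f \<in> dual_cone C \<and> g \<in> dual_cone C} = UNIV"
    and weak: "0 \<notin> weak_topology closure_of (C - ball 0 \<epsilon>)"
  obtains F :: "'a \<Rightarrow>\<^sub>L real" where "\<And>c. c \<in> C \<Longrightarrow> norm c \<le> blinfun_apply F c"
proof -
  obtain I :: "('a \<Rightarrow>\<^sub>L real) set" and K where I: "finite I" "0 < K"
    and bound: "\<And>c. c \<in> C \<Longrightarrow> norm c \<le> K * (\<Sum>f\<in>I. \<bar>blinfun_apply f c\<bar>)"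
    using norm_le_sum_functionals[OF C \<epsilon> weak] by metis
  \<comment> \<open>the summand \<open>1\<close> keeps the denominator positive when \<open>I\<close> is empty\<close>
  define \<eta> where "\<eta> = 1 / (2 * K * (card I + 1))"
  have \<eta>: "0 < \<eta>" "K * (card I * \<eta>) \<le> 1 / 2"
  proof -
    show "0 < \<eta>"
      using I(2) by (simp add: \<eta>_def)
    have "K * (card I * \<eta>) = card I / (2 * (card I + 1))"
      using I(2) by (simp add: \<eta>_def)
    also have "\<dots> \<le> 1 / 2"
      by (simp add: field_simps)
    finally show "K * (card I * \<eta>) \<le> 1 / 2" .
  qed
  have "\<exists>g h. g \<in> dual_cone C \<and> h \<in> dual_cone C \<and> dist (g - h) f < \<eta>" for f :: "'a \<Rightarrow>\<^sub>L real"
  proof -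
    have "f \<in> closure {f - g | f g. f \<in> dual_cone C \<and> g \<in> dual_cone C}"
      using dense by simp
    with \<eta>(1) show ?thesis unfolding closure_approachable by blast
  qed
  then obtain g h :: "('a \<Rightarrow>\<^sub>L real) \<Rightarrow> ('a \<Rightarrow>\<^sub>L real)"
    where gh: "\<And>f. g f \<in> dual_cone C" "\<And>f. h f \<in> dual_cone C" "\<And>f. dist (g f - h f) f < \<eta>"
    by metis
  define G where "G = (\<Sum>f\<in>I. g f + h f)"
  have "norm c \<le> blinfun_apply ((2 * K) *\<^sub>R G) c" if c: "c \<in> C" for c
  proof -
    have "\<bar>blinfun_apply f c\<bar> \<le> blinfun_apply (g f + h f) c + \<eta> * norm c" for f
    proof -
      have "\<bar>blinfun_apply (g f - h f - f) c\<bar> \<le> norm (g f - h f - f) * norm c"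
        using norm_blinfun[of "g f - h f - f" c] by simp
      also have "\<dots> \<le> \<eta> * norm c"
        using gh(3)[of f] by (intro mult_right_mono) (auto simp: dist_norm)
      finally have "\<bar>blinfun_apply (g f) c - blinfun_apply (h f) c - blinfun_apply f c\<bar> \<le> \<eta> * norm c"
        by (simp add: blinfun.diff_left)
      moreover have "0 \<le> blinfun_apply (g f) c" "0 \<le> blinfun_apply (h f) c"
        using gh(1,2)[of f] c by (auto simp: dual_cone_def)
      ultimately show ?thesis by (simp add: blinfun.add_left)
    qed
    then have "(\<Sum>f\<in>I. \<bar>blinfun_apply f c\<bar>) \<le> (\<Sum>f\<in>I. blinfun_apply (g f + h f) c + \<eta> * norm c)"
      by (rule sum_mono)
    also have "\<dots> = blinfun_apply G c + card I * \<eta> * norm c"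
      unfolding G_def blinfun.sum_left by (simp add: sum.distrib)
    finally have "K * (\<Sum>f\<in>I. \<bar>blinfun_apply f c\<bar>) \<le> K * (blinfun_apply G c + card I * \<eta> * norm c)"
      using I(2) by (intro mult_left_mono) auto
    with bound[OF c] have "norm c \<le> K * blinfun_apply G c + K * (card I * \<eta>) * norm c"
      by (simp add: algebra_simps)
    moreover have "K * (card I * \<eta>) * norm c \<le> 1 / 2 * norm c"
      using \<eta>(2) by (rule mult_right_mono) simp
    ultimately show ?thesis by (simp add: blinfun.scaleR_left)
  qed
  then show ?thesis by (rule that)
qed

section \<open>The equivalence\<close>

theorem corollary1:
  fixes C :: "'a::real_normed_vector set"
  assumes "convex_cone C"
    and "C \<noteq> {0}"
    and "closure {f - g | f g. f \<in> dual_cone C \<and> g \<in> dual_cone C} = UNIV"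
  shows "(\<forall>\<epsilon>::real. 0 < \<epsilon> \<and> \<epsilon> < 1 \<longrightarrow>
            0 \<notin> weak_topology closure_of (C - (\<lambda>x. \<epsilon> *\<^sub>R x) ` ball 0 1))
         \<longleftrightarrow> (\<exists>B. is_base C B \<and> bounded B)"
    (is "?weak \<longleftrightarrow> ?base")
proof -
  have ball: "(\<lambda>x. \<epsilon> *\<^sub>R x) ` ball 0 1 = (ball 0 \<epsilon> :: 'a set)" if "0 < \<epsilon>" for \<epsilon> :: real
    using ball_scale[of \<epsilon> "0 :: 'a" 1] that by simp
  have "?weak \<longleftrightarrow> (\<exists>F :: 'a \<Rightarrow>\<^sub>L real. \<forall>c\<in>C. norm c \<le> blinfun_apply F c)"
  proof
    assume ?weak
    \<comment> \<open>any other value in the open unit interval would do as well\<close>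
    then have "0 \<notin> weak_topology closure_of (C - (\<lambda>x. (1/2) *\<^sub>R x) ` ball 0 1)"
      by (elim allE[where x = "1/2"]) simp
    then have "0 \<notin> weak_topology closure_of (C - ball 0 (1/2))"
      by (simp add: ball)
    then show "\<exists>F :: 'a \<Rightarrow>\<^sub>L real. \<forall>c\<in>C. norm c \<le> blinfun_apply F c"
      by (rule norm_dominated_if_weakly_separated[OF assms(1) _ assms(3), rotated]) auto
  next
    assume "\<exists>F :: 'a \<Rightarrow>\<^sub>L real. \<forall>c\<in>C. norm c \<le> blinfun_apply F c"
    then show ?weak
      using zero_notin_weak_closure_if_norm_dominated[of C] by (metis ball)
  qed
  also have "\<dots> \<longleftrightarrow> ?base"
    using bounded_base_iff_norm_dominated[OF assms(1,2)] by simp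
  finally show ?thesis .
qed

end
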